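(* Let $\alpha>-1$ be real and let $n\ge5$ be an integer. For $t\in[0,1]$ let $g_{n,\alpha}(t)$ denote the product of the smallest and largest zeros of the polynomial (in $x$) $$\widehat L_{n+1}^{(\alpha)}(x,t)=\bigl(x-(2n+\alpha+1)\bigr)p_n(x)-n(n+\alpha)t^2p_{n-1}(x).$$ Then there exists a unique $t_*\in(0,1)$ such that $g_{n,\alpha}$ is strictly increasing on $[0,t_*]$ and strictly decreasing on $[t_*,1]$. Moreover, $$g_{n,\alpha}(t)>g_{n,\alpha}(0)\quad\text{for all } 0<t\le1.$$
   Context: For real $\alpha>-1$ and an integer $m\ge 0$, $L_m^{(\alpha)}$ is the generalised Laguerre polynomial of degree $m$ in the standard normalisation, $$L_m^{(\alpha)}(x)=\sum_{k=0}^m(-1)^k\binom{m+\alpha}{m-k}\frac{x^k}{k!},$$ and $p_m(x)=(-1)^m m!\,L_m^{(\alpha)}(x)$ is its monic version (the dependence on $\alpha$ is suppressed in the notation). For $0\le t\le 1$ the polynomial $\widehat L_{n+1}^{(\alpha)}(\cdot,t)$ has degree $n+1$ and is the characteristic polynomial of a real symmetric tridiagonal matrix, so all its zeros are real and its smallest and largest zeros are well defined. *)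

theory Defs
  imports "HOL-Computational_Algebra.Polynomial"
begin

definition laguerre :: "real \<Rightarrow> nat \<Rightarrow> real poly" where
  "laguerre \<alpha> m =
     (\<Sum>k\<le>m. monom ((-1) ^ k * ((real m + \<alpha>) gchoose (m - k)) / fact k) k)"

definition monic_laguerre :: "real \<Rightarrow> nat \<Rightarrow> real poly" where
  "monic_laguerre \<alpha> m = smult ((-1) ^ m * fact m) (laguerre \<alpha> m)"

text \<open>The index of \<open>laguerre_hat \<alpha> n t\<close> is shifted: for \<open>n \<ge> 1\<close> it is the polynomial of
  degree \<open>n + 1\<close> written $\widehat L_{n+1}^{(\alpha)}(\cdot,t)$.\<close>

definition laguerre_hat :: "real \<Rightarrow> nat \<Rightarrow> real \<Rightarrow> real poly" where
  "laguerre_hat \<alpha> n t =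
     [: - (2 * real n + \<alpha> + 1), 1 :] * monic_laguerre \<alpha> n
       - smult (real n * (real n + \<alpha>) * t\<^sup>2) (monic_laguerre \<alpha> (n - 1))"

text \<open>For \<open>\<alpha> > -1\<close>, \<open>n \<ge> 1\<close> and \<open>0 \<le> t \<le> 1\<close> all complex zeros of \<open>laguerre_hat \<alpha> n t\<close> are
  real, so the set of real zeros below is finite, nonempty and contains every zero.\<close>

definition extreme_zeros_prod :: "nat \<Rightarrow> real \<Rightarrow> real \<Rightarrow> real" where
  "extreme_zeros_prod n \<alpha> t =
     Min {x. poly (laguerre_hat \<alpha> n t) x = 0} * Max {x. poly (laguerre_hat \<alpha> n t) x = 0}"

end

theory Submission
  imports Defs
begin

text \<open>
  Put \<open>n = m + 1\<close>, \<open>a = 2 n + \<alpha> + 1\<close>, \<open>b = n (n + \<alpha>)\<close> and \<open>s = t\<^sup>2\<close>. The zeros in question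
  solve \<open>(x - a) p\<^sub>n(x) = s b p\<^sub>n\<^sub>-\<^sub>1(x)\<close>. While \<open>s\<close> runs from \<open>0\<close> to \<open>1\<close>, the smallest one, \<open>u\<close>,
  moves to the left and the largest one, \<open>v\<close>, to the right, from the extreme zeros of \<open>p\<^sub>n\<close> to
  those of \<open>p\<^sub>n\<^sub>+\<^sub>1\<close>.

  \<^bold>\<open>Equation of motion.\<close> The quotient \<open>p\<^sub>n\<^sub>-\<^sub>1 / p\<^sub>n\<close> satisfies a Riccati equation. Along a zero the
  quotient equals \<open>(x - a) / (s b)\<close>, and eliminating it leaves an equation in which no Laguerre
  polynomial occurs: with \<open>X = x - a\<close>,
  \<open>d (log x) / ds = X / (X\<^sup>2 (1 - s) + a s + b s\<^sup>2)\<close> (lemma \<open>zero_has_derivative\<close>). Writing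
  \<open>U = a - u\<close> and \<open>V = v - a\<close>, the product \<open>u v\<close> therefore increases or decreases according to
  the sign of \<open>(U - V) (U V (1 - s) - a s - b s\<^sup>2)\<close>.

  \<^bold>\<open>The first factor is positive.\<close> The polynomial is the characteristic polynomial of a Jacobi
  matrix \<open>J\<close> whose largest diagonal entry is \<open>a\<close>. After a change of signs in the basis, \<open>a - J\<close>
  has nonnegative entries, so by Perron's argument its largest eigenvalue \<open>U\<close> dominates the
  modulus \<open>V\<close> of its smallest one. Here the argument is carried out on quotients of consecutive
  members of the recurrence (\<open>ratio_less_ratio\<close>, \<open>V_less_U\<close>).

  \<^bold>\<open>The second factor changes sign once.\<close> It is positive at \<open>s = 0\<close>, because the largest
  zero of \<open>p\<^sub>n\<close> exceeds \<open>a\<close>, which is what \<open>n \<ge> 5\<close> ensures (\<open>a_less_up_top\<close>), and negative at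
  \<open>s = 1\<close>. At any zero of this factor, the identity \<open>u V + v U = a (U + V)\<close> makes its
  derivative collapse to \<open>- U V - 2 b s < 0\<close>. Hence there is exactly one zero, and the product is
  unimodal.

  \<^bold>\<open>The endpoints.\<close> By unimodality the last claim reduces to comparing \<open>s = 0\<close> with \<open>s = 1\<close>: the
  product of the extreme zeros of \<open>p\<^sub>n\<^sub>+\<^sub>1\<close> exceeds that of \<open>p\<^sub>n\<close>. Start at the extreme zeros
  \<open>u\<^sub>1 < v\<^sub>1\<close> of \<open>p\<^sub>n\<^sub>+\<^sub>1\<close> and move inwards at equal logarithmic speed, \<open>x = u\<^sub>1 e\<^sup>\<theta>\<close> and
  \<open>y = v\<^sub>1 e\<^sup>-\<^sup>\<theta>\<close>. The quotient \<open>p\<^sub>n\<^sub>+\<^sub>1 / p\<^sub>n\<close> satisfies similar Riccati equations at the two points,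
  with a faster growth at \<open>x\<close> because \<open>x + y < 2 a\<close>; so \<open>x\<close> reaches a zero of \<open>p\<^sub>n\<close> before \<open>y\<close>
  does, which is the required inequality. The comparison of the two quotients is made through
  their cross Wronskian, which has no poles (\<open>cross_wronskian_derivative\<close>,
  \<open>zero_prod_0_less_zero_prod_1\<close>).
\<close>

section \<open>Functions that decrease at each of their zeros\<close>

text \<open>A function that decreases through each of its zeros cannot return to zero: just to the right of
  a zero it is negative, and at the next zero it would have to be positive just to the left.\<close>

lemma unique_sign_change_if_decreasing_at_zeros:
  fixes f :: "real \<Rightarrow> real"
  assumes "a < b" and cont: "continuous_on {a..b} f" and fa: "f a > 0" and fb: "f b < 0"
    and down: "\<And>x. a < x \<Longrightarrow> x < b \<Longrightarrow> f x = 0 \<Longrightarrow> \<exists>D<0. (f has_real_derivative D) (at x)"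
  obtains c where "a < c" "c < b" "\<And>x. a \<le> x \<Longrightarrow> x < c \<Longrightarrow> f x > 0"
    "\<And>x. c < x \<Longrightarrow> x \<le> b \<Longrightarrow> f x < 0"
proof -
  obtain c where c: "a \<le> c" "c \<le> b" "f c = 0"
    using IVT2'[of f b 0 a] assms by fastforce
  have c': "a < c" "c < b"
    using c fa fb by (auto simp: order_less_le)
  have neg_after: "f y < 0" if xy: "a < x" "f x = 0" "x < y" "y \<le> b" for x y
  proof (rule ccontr)
    assume "\<not> f y < 0"
    hence fy: "f y \<ge> 0" by simp
    have "y < b" using fy fb xy by (cases "y = b") auto
    from down[of x] xy obtain D where "D < 0" "(f has_real_derivative D) (at x)" by auto
    from DERIV_neg_dec_right[OF this(2,1)] obtain \<delta>
      where \<delta>: "\<delta> > 0" "\<And>h. h > 0 \<Longrightarrow> h < \<delta> \<Longrightarrow> f (x + h) < 0" using xy by auto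
    define x' where "x' = x + min \<delta> (y - x) / 2"
    have x': "x < x'" "x' < y" "f x' < 0"
      using \<delta> xy \<delta>(2)[of "min \<delta> (y - x) / 2"] by (auto simp: x'_def min_def field_simps)
    have cont': "continuous_on {x'..y} f"
      by (rule continuous_on_subset[OF cont]) (use x' xy in auto)
    \<comment> \<open>Compactness provides the first zero \<open>w\<close> after \<open>x'\<close>; decrease at \<open>w\<close> forces an earlier one.\<close>
    let ?Z = "f -` {0} \<inter> {x'..y}"
    have "closed ?Z"
      using cont' continuous_on_closed_vimage[of "{x'..y}" f] by auto
    hence "compact ({x'..y} \<inter> ?Z)"
      by (intro compact_Int_closed compact_Icc)
    moreover have "{x'..y} \<inter> ?Z \<noteq> {}"
      using IVT'[of f x' 0 y] x' fy cont' by fastforce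
    ultimately obtain w where w: "w \<in> {x'..y} \<inter> ?Z" "\<forall>t\<in>{x'..y} \<inter> ?Z. w \<le> t"
      using compact_attains_inf by metis
    have "x' < w" using w x' by (cases "w = x'") auto
    from down[of w] w x' xy \<open>y < b\<close> obtain D where "D < 0" "(f has_real_derivative D) (at w)"
      by auto
    from DERIV_neg_dec_left[OF this(2,1)] obtain \<delta>
      where \<delta>: "\<delta> > 0" "\<And>h. h > 0 \<Longrightarrow> h < \<delta> \<Longrightarrow> f (w - h) > 0" using w by auto
    define w' where "w' = w - min \<delta> (w - x') / 2"
    have w': "x' < w'" "w' < w" "f w' > 0"
      using \<delta> \<open>x' < w\<close> \<delta>(2)[of "min \<delta> (w - x') / 2"]
      by (auto simp: w'_def min_def field_simps)
    have "continuous_on {x'..w'} f"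
      by (rule continuous_on_subset[OF cont']) (use w w' in auto)
    then obtain t where "x' \<le> t" "t \<le> w'" "f t = 0"
      using IVT'[of f x' 0 w'] x' w' by force
    thus False using w w' by force
  qed
  show ?thesis
  proof (rule that[OF c'])
    show "f x < 0" if "c < x" "x \<le> b" for x
      using neg_after[of c x] that c c' by auto
    show "f x > 0" if x: "a \<le> x" "x < c" for x
    proof (rule ccontr)
      assume n: "\<not> f x > 0"
      have "\<exists>t. a \<le> t \<and> t \<le> x \<and> f t = 0"
      proof (rule IVT2')
        show "continuous_on {a..x} f"
          by (rule continuous_on_subset[OF cont]) (use x c' in auto)
      qed (use n fa x in auto)
      then obtain t where t: "a \<le> t" "t \<le> x" "f t = 0" by blast
      with fa have "a < t" by (cases "t = a") auto
      from neg_after[OF this, of c] t x c c' show False by auto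
    qed
  qed
qed

section \<open>Largest zeros of polynomials defined by a three-term recurrence\<close>

text \<open>Only the growth to the right of the largest zero is studied. Smallest zeros are covered by
  applying the results to the reflected sequence \<open>(-1)\<^sup>k P\<^sub>k (- x)\<close>, for which \<open>d\<close> changes sign and
  \<open>e\<close> is the same. The members of the sequence are functions, so that the reflection needs no
  algebra of polynomials.\<close>

locale monic_recurrence =
  fixes P :: "nat \<Rightarrow> real \<Rightarrow> real" and d e :: "nat \<Rightarrow> real"
  assumes P_0 [simp]: "P 0 x = 1"
    and P_1: "P (Suc 0) x = x - d 0"
    and P_rec: "P (Suc (Suc k)) x = (x - d (Suc k)) * P (Suc k) x - e (Suc k) * P k x"
    and e_pos: "e (Suc k) > 0"
begin

definition ratio :: "nat \<Rightarrow> real \<Rightarrow> real" where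
  "ratio k x = P (Suc k) x / P k x"

lemma ratio_0: "ratio 0 x = x - d 0"
  by (simp add: ratio_def P_1)

lemma ratio_Suc:
  assumes "P k x > 0" "P (Suc k) x > 0"
  shows "ratio (Suc k) x = x - d (Suc k) - e (Suc k) / ratio k x"
  using assms by (simp add: ratio_def P_rec field_simps)

lemma ratio_pos: "P k x > 0 \<Longrightarrow> P (Suc k) x > 0 \<Longrightarrow> ratio k x > 0"
  by (simp add: ratio_def)

lemma P_Suc_eq_ratio: "P k x > 0 \<Longrightarrow> P (Suc k) x = ratio k x * P k x"
  by (simp add: ratio_def)

lemma continuous_P: "continuous_on A (P k)"
proof -
  have "continuous_on A (P k) \<and> continuous_on A (P (Suc k))"
  proof (induction k)
    case 0
    have "P 0 = (\<lambda>_. 1)" "P (Suc 0) = (\<lambda>x. x - d 0)" by (auto simp: P_1)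
    thus ?case by (auto intro!: continuous_intros)
  next
    case (Suc k)
    have "P (Suc (Suc k)) = (\<lambda>x. (x - d (Suc k)) * P (Suc k) x - e (Suc k) * P k x)"
      by (auto simp: P_rec)
    thus ?case using Suc by (auto intro!: continuous_intros)
  qed
  thus ?thesis by simp
qed

text \<open>By the recurrence, a ratio is \<open>x - d\<^sub>k\<close> minus a positive multiple of the reciprocal of the
  preceding ratio. Hence ratios inherit from each other that they increase with slope at
  least \<open>1\<close>, as long as the sequence is positive; and it stays positive because they increase.\<close>

lemma pos_above_and_ratio_growth:
  assumes "\<forall>k\<le>m. P k y > 0" and "y \<le> x"
  shows "(\<forall>k\<le>m. P k x > 0) \<and> ratio m y + (x - y) \<le> ratio m x"
  using assms(1)
proof (induction m)
  case 0
  thus ?case by (simp add: ratio_0)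
next
  case (Suc m)
  hence IH: "\<forall>k\<le>m. P k x > 0" "ratio m y + (x - y) \<le> ratio m x" by auto
  have ry: "ratio m y > 0" using Suc.prems by (simp add: ratio_pos)
  hence rx: "ratio m x > 0" "ratio m y \<le> ratio m x" using IH(2) assms(2) by linarith+
  have pos: "P (Suc m) x > 0" using P_Suc_eq_ratio[of m x] IH(1) rx by auto
  have "e (Suc m) / ratio m x \<le> e (Suc m) / ratio m y"
    using rx ry e_pos[of m] by (intro divide_left_mono) auto
  hence "ratio (Suc m) y + (x - y) \<le> ratio (Suc m) x"
    using ratio_Suc[of m x] ratio_Suc[of m y] IH(1) pos Suc.prems by auto
  thus ?case using IH(1) pos by (auto simp: le_Suc_eq)
qed

lemmas pos_above = pos_above_and_ratio_growth[THEN conjunct1, rule_format]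
lemmas ratio_growth = pos_above_and_ratio_growth[THEN conjunct2]

text \<open>At the largest zero of \<open>P\<^sub>m\<^sub>+\<^sub>1\<close> the recurrence makes \<open>P\<^sub>m\<^sub>+\<^sub>2\<close> negative, so that it has a zero
  further to the right. This replaces the theory of interlacing.\<close>

lemma ex_top: "\<exists>\<beta>. P (Suc m) \<beta> = 0 \<and> (\<forall>k\<le>m. P k \<beta> > 0)"
proof (induction m)
  case 0
  show ?case by (rule exI[of _ "d 0"]) (simp add: P_1)
next
  case (Suc m)
  then obtain \<beta> where \<beta>: "P (Suc m) \<beta> = 0" "\<forall>k\<le>m. P k \<beta> > 0" by blast
  have above: "\<forall>k\<le>Suc m. P k x > 0" if "\<beta> < x" for x
  proof -
    have "ratio m x > 0" using ratio_growth[of m \<beta> x] \<beta> that by (simp add: ratio_def)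
    thus ?thesis using pos_above[of m \<beta> x] P_Suc_eq_ratio[of m x] \<beta> that
      by (auto simp: le_Suc_eq)
  qed
  define x0 where "x0 = \<beta> + 1"
  \<comment> \<open>Slope at least \<open>1\<close> brings the ratio from its value at \<open>x0\<close> up to \<open>0\<close> by \<open>x1\<close>.\<close>
  define x1 where "x1 = x0 + \<bar>ratio (Suc m) x0\<bar>"
  have "ratio (Suc m) x1 \<ge> 0"
    using ratio_growth[of "Suc m" x0 x1] above[of x0] unfolding x1_def x0_def by auto
  moreover have "P (Suc m) x1 > 0" using above[of x1] unfolding x1_def x0_def by auto
  ultimately have x1: "P (Suc (Suc m)) x1 \<ge> 0" using P_Suc_eq_ratio[of "Suc m" x1] by auto
  have neg: "P (Suc (Suc m)) \<beta> < 0" using \<beta> e_pos[of m] by (simp add: P_rec)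
  have "\<beta> \<le> x1" by (simp add: x1_def x0_def)
  then obtain \<gamma> where \<gamma>: "\<beta> \<le> \<gamma>" "P (Suc (Suc m)) \<gamma> = 0"
    using IVT'[of "P (Suc (Suc m))" \<beta> 0 x1] neg x1 continuous_P by (metis less_eq_real_def)
  with neg have "\<beta> < \<gamma>" by (cases "\<gamma> = \<beta>") auto
  with \<gamma> above[of \<gamma>] show ?case by blast
qed

text \<open>The largest zero of \<open>P (Suc m)\<close>; the index \<open>m\<close> is that of the last member that is still positive
  there.\<close>

definition top_zero :: "nat \<Rightarrow> real" where
  "top_zero m = (SOME \<beta>. P (Suc m) \<beta> = 0 \<and> (\<forall>k\<le>m. P k \<beta> > 0))"

lemma P_top: "P (Suc m) (top_zero m) = 0"
  and P_pos_top: "k \<le> m \<Longrightarrow> P k (top_zero m) > 0"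
  using someI_ex[OF ex_top[of m]] unfolding top_zero_def by blast+

lemma ratio_top: "ratio m (top_zero m) = 0"
  by (simp add: ratio_def P_top)

lemma P_pos: "top_zero m \<le> x \<Longrightarrow> k \<le> m \<Longrightarrow> P k x > 0"
  using pos_above[of m "top_zero m" x k] P_pos_top by blast

lemma P_pos_strict: 
  assumes "top_zero m < x" "k \<le> Suc m" shows "P k x > 0"
proof (cases "k = Suc m")
  case True
  have "ratio m x > 0" using ratio_growth[of m "top_zero m" x] P_pos_top assms by (simp add: ratio_top)
  thus ?thesis using True P_Suc_eq_ratio[of m x] P_pos[of m x m] assms by auto
next
  case False
  thus ?thesis using P_pos[of m x k] assms by simp
qed

lemma ratio_nonneg: "top_zero m \<le> x \<Longrightarrow> ratio m x \<ge> 0"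
  using ratio_growth[of m "top_zero m" x] P_pos_top by (simp add: ratio_top)

text \<open>The parameter \<open>s\<close> for which \<open>x\<close> is a zero of \<open>(x - d\<^sub>m\<^sub>+\<^sub>1) P\<^sub>m\<^sub>+\<^sub>1(x) - s e\<^sub>m\<^sub>+\<^sub>1 P\<^sub>m(x)\<close>.\<close>

definition level :: "nat \<Rightarrow> real \<Rightarrow> real" where
  "level m x = (x - d (Suc m)) * ratio m x / e (Suc m)"

text \<open>The linear lower bound gives at once that the level takes every nonnegative value exactly once
  on the half-line from \<open>top_zero m\<close>, and that its inverse is Lipschitz continuous.\<close>

lemma level_growth:
  assumes "d (Suc m) < top_zero m" "top_zero m \<le> x" "x \<le> y"
  shows "(top_zero m - d (Suc m)) / e (Suc m) * (y - x) \<le> level m y - level m x"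
proof -
  have r: "ratio m x + (y - x) \<le> ratio m y" 
    using ratio_growth[of m x y] P_pos assms by auto
  have "(top_zero m - d (Suc m)) * (y - x) \<le> (y - d (Suc m)) * (ratio m y - ratio m x)"
    using assms r by (intro mult_mono) auto
  also have "\<dots> \<le> (y - d (Suc m)) * (ratio m y - ratio m x) + (y - x) * ratio m x"
    using assms ratio_nonneg[of m x] by simp
  also have "\<dots> = (y - d (Suc m)) * ratio m y - (x - d (Suc m)) * ratio m x"
    by (simp add: algebra_simps)
  finally have "(top_zero m - d (Suc m)) * (y - x) / e (Suc m)
      \<le> ((y - d (Suc m)) * ratio m y - (x - d (Suc m)) * ratio m x) / e (Suc m)"
    using e_pos[of m] by (intro divide_right_mono) auto
  thus ?thesis by (simp add: level_def flip: diff_divide_distrib)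
qed

lemma level_strict_mono:
  assumes "d (Suc m) < top_zero m" "top_zero m \<le> x" "x < y"
  shows "level m x < level m y"
proof -
  have "0 < (top_zero m - d (Suc m)) / e (Suc m) * (y - x)" using assms e_pos[of m] by simp
  thus ?thesis using level_growth[of m x y] assms by simp
qed

lemma continuous_level: "continuous_on {top_zero m..} (level m)"
  unfolding level_def[abs_def] ratio_def[abs_def]
  using P_pos[of m _ m] e_pos[of m]
  by (intro continuous_intros continuous_P) (auto simp: less_imp_neq[symmetric])

lemma level_top: "level m (top_zero m) = 0"
  by (simp add: level_def ratio_top)

lemma ex_level_eq:
  assumes "d (Suc m) < top_zero m" "0 \<le> s"
  shows "\<exists>x\<ge>top_zero m. level m x = s"
proof -
  define c where "c = (top_zero m - d (Suc m)) / e (Suc m)"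
  have c: "c > 0" using assms e_pos[of m] by (simp add: c_def)
  define y where "y = top_zero m + s / c"
  have y: "top_zero m \<le> y" using c assms by (simp add: y_def)
  have "s \<le> level m y" using level_growth[of m "top_zero m" y] assms y c 
    unfolding c_def[symmetric] by (simp add: y_def level_top)
  moreover have "continuous_on {top_zero m..y} (level m)"
    by (rule continuous_on_subset[OF continuous_level]) auto
  ultimately show ?thesis
    using IVT'[of "level m" "top_zero m" s y] assms y by (auto simp: level_top)
qed

text \<open>The inverse function of the level on the half-line from \<open>top_zero m\<close>. If
  \<open>d (Suc m) < top_zero m\<close>, it gives the largest zero of
  \<open>(x - d\<^sub>m\<^sub>+\<^sub>1) P\<^sub>m\<^sub>+\<^sub>1(x) - s e\<^sub>m\<^sub>+\<^sub>1 P\<^sub>m(x)\<close> as a function of \<open>s\<close>.\<close>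

definition deformed_zero :: "nat \<Rightarrow> real \<Rightarrow> real" where
  "deformed_zero m s = (SOME x. top_zero m \<le> x \<and> level m x = s)"

context
  fixes m assumes d_less_top: "d (Suc m) < top_zero m"
begin

lemma top_le_deformed_zero: "0 \<le> s \<Longrightarrow> top_zero m \<le> deformed_zero m s"
  and level_deformed_zero: "0 \<le> s \<Longrightarrow> level m (deformed_zero m s) = s"
  using someI_ex[OF ex_level_eq[OF d_less_top, of s, unfolded]] unfolding deformed_zero_def by blast+

lemma level_le_iff: "top_zero m \<le> x \<Longrightarrow> top_zero m \<le> y \<Longrightarrow> level m x \<le> level m y \<longleftrightarrow> x \<le> y"
  using level_strict_mono[OF d_less_top] by (metis linorder_le_less_linear less_eq_real_def not_le)

lemma deformed_zero_mono: "0 \<le> s \<Longrightarrow> s \<le> s' \<Longrightarrow> deformed_zero m s \<le> deformed_zero m s'"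
  using level_le_iff[of "deformed_zero m s" "deformed_zero m s'"] by (simp add: top_le_deformed_zero level_deformed_zero)

lemma deformed_zero_0: "deformed_zero m 0 = top_zero m"
  using level_le_iff[of "deformed_zero m 0" "top_zero m"] top_le_deformed_zero[of 0] by (simp add: level_deformed_zero level_top)

lemma deformed_zero_strict_mono: "0 \<le> s \<Longrightarrow> s < s' \<Longrightarrow> deformed_zero m s < deformed_zero m s'"
  using deformed_zero_mono[of s s'] level_deformed_zero[of s] level_deformed_zero[of s'] by (cases "deformed_zero m s = deformed_zero m s'") auto

lemma continuous_deformed_zero: "continuous_on {0..} (deformed_zero m)"
proof -
  define c where "c = (top_zero m - d (Suc m)) / e (Suc m)"
  have c: "c > 0" using d_less_top e_pos[of m] by (simp add: c_def)
  have lip: "c * (deformed_zero m s' - deformed_zero m s) \<le> s' - s" if "0 \<le> s" "s \<le> s'" for s s'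
    using level_growth[OF d_less_top, of "deformed_zero m s" "deformed_zero m s'"] that deformed_zero_mono[of s s']
    by (simp add: c_def top_le_deformed_zero level_deformed_zero)
  have *: "c * dist (deformed_zero m s') (deformed_zero m s) \<le> dist s' s"
    if "0 \<le> s" "0 \<le> s'" for s s'
    using lip[of s s'] lip[of s' s] deformed_zero_mono[of s s'] deformed_zero_mono[of s' s] that
    by (cases "s \<le> s'") (auto simp: dist_real_def)
  show ?thesis
    unfolding continuous_on_def tendsto_iff eventually_at
  proof (intro ballI allI impI)
    fix s \<epsilon> :: real assume s: "s \<in> {0..}" and \<epsilon>: "\<epsilon> > 0"
    have "dist (deformed_zero m s') (deformed_zero m s) < \<epsilon>"
      if "s' \<in> {0..}" "dist s' s < c * \<epsilon>" for s'
    proof -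
      have "c * dist (deformed_zero m s') (deformed_zero m s) < c * \<epsilon>"
        using *[of s s'] s that by auto
      thus ?thesis using c by simp
    qed
    thus "\<exists>\<delta>>0. \<forall>s'\<in>{0..}. s' \<noteq> s \<and> dist s' s < \<delta>
            \<longrightarrow> dist (deformed_zero m s') (deformed_zero m s) < \<epsilon>"
      using c \<epsilon> by (intro exI[of _ "c * \<epsilon>"]) auto
  qed
qed

lemma deformed_zero_is_zero:
  assumes "0 \<le> s"
  shows "(deformed_zero m s - d (Suc m)) * P (Suc m) (deformed_zero m s) - s * e (Suc m) * P m (deformed_zero m s) = 0"
proof -
  have "P m (deformed_zero m s) > 0" using P_pos[OF top_le_deformed_zero[OF assms], of m] by simp
  moreover have "s * e (Suc m) = (deformed_zero m s - d (Suc m)) * ratio m (deformed_zero m s)"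
    using level_deformed_zero[OF assms] e_pos[of m] by (simp add: level_def field_simps)
  ultimately show ?thesis by (simp add: ratio_def)
qed

lemma zero_le_deformed_zero:
  assumes "0 \<le> s" "(x - d (Suc m)) * P (Suc m) x - s * e (Suc m) * P m x = 0"
  shows "x \<le> deformed_zero m s"
proof (cases "top_zero m \<le> x")
  case True
  have "P m x > 0" using P_pos True by simp
  hence "level m x = s"
    using assms(2) e_pos[of m] by (simp add: level_def ratio_def field_simps)
  thus ?thesis using level_le_iff[of x "deformed_zero m s"] True assms by (simp add: top_le_deformed_zero level_deformed_zero)
next
  case False
  thus ?thesis using top_le_deformed_zero[OF assms(1)] by simp
qed

end

end

text \<open>The core of Perron's argument. In the application \<open>Q\<close> is the reflection of \<open>P\<close> and the two
  points are \<open>x = c + V\<close> and \<open>y = - c + V\<close>, where \<open>c\<close> exceeds all \<open>d\<^sub>k\<close>: the diagonal terms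
  \<open>c - d\<^sub>k\<close> raise the ratios on one side and lower them on the other.\<close>

lemma ratio_less_ratio:
  assumes "monic_recurrence P d e" and "monic_recurrence Q d' e"
    and "\<forall>k\<le>m. P k x > 0" and "\<forall>k\<le>m. Q k y > 0"
    and "\<forall>k\<le>m. y - d' k < x - d k"
  shows "Q (Suc m) y / Q m y < P (Suc m) x / P m x"
proof -
  interpret P: monic_recurrence P d e by fact
  interpret Q: monic_recurrence Q d' e by fact
  have "Q.ratio m y < P.ratio m x"
    using assms(3-)
  proof (induction m)
    case 0
    thus ?case by (simp add: P.ratio_0 Q.ratio_0)
  next
    case (Suc m)
    hence IH: "Q.ratio m y < P.ratio m x" by simp
    have "Q.ratio m y > 0" using Suc.prems by (simp add: Q.ratio_pos)
    hence "e (Suc m) / P.ratio m x < e (Suc m) / Q.ratio m y"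
      using IH P.e_pos[of m] by (intro divide_strict_left_mono) auto
    moreover have "y - d' (Suc m) < x - d (Suc m)" using Suc.prems by blast
    ultimately show ?case
      using P.ratio_Suc[of m x] Q.ratio_Suc[of m y] Suc.prems by auto
  qed
  thus ?thesis by (simp add: P.ratio_def Q.ratio_def)
qed

section \<open>Laguerre polynomials\<close>

lemma coeff_monic_laguerre:
  "coeff (monic_laguerre \<alpha> m) k =
     (if k \<le> m then (-1) ^ (m + k) * fact m / fact k * ((real m + \<alpha>) gchoose (m - k)) else 0)"
proof -
  have "coeff (laguerre \<alpha> m) k =
     (if k \<le> m then (-1) ^ k * ((real m + \<alpha>) gchoose (m - k)) / fact k else 0)"
    by (simp add: laguerre_def coeff_sum)
  thus ?thesis by (simp add: monic_laguerre_def power_add)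
qed

lemma coeff_pCons_0_pderiv: "coeff (pCons 0 (pderiv p)) k = of_nat k * coeff p k"
  by (cases k) (simp_all add: coeff_pderiv)

lemma coeff_monic_laguerre_degree_step:
  "(real k - real (Suc n)) * coeff (monic_laguerre \<alpha> (Suc n)) k =
     real (Suc n) * (real (Suc n) + \<alpha>) * coeff (monic_laguerre \<alpha> n) k"
proof (cases "k \<le> n")
  case True
  then obtain j where n: "n = k + j" by (auto simp: le_iff_add)
  define \<sigma> where "\<sigma> = (-1) ^ (n + k) * fact n / (fact k :: real)"
  let ?A = "real n + \<alpha>"
  have "coeff (monic_laguerre \<alpha> (Suc n)) k = - \<sigma> * real (Suc n) * (?A + 1 gchoose Suc j)"
    using n by (simp add: coeff_monic_laguerre \<sigma>_def fact_Suc Suc_diff_le add_ac mult_ac del: of_nat_Suc)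
      (simp add: add_ac)
  moreover have "real k - real (Suc n) = - real (Suc j)"
    using n by simp
  ultimately have "(real k - real (Suc n)) * coeff (monic_laguerre \<alpha> (Suc n)) k =
      \<sigma> * real (Suc n) * (real (Suc j) * (?A + 1 gchoose Suc j))"
    by (simp add: mult_ac del: of_nat_Suc)
  also have "\<dots> = \<sigma> * real (Suc n) * ((?A + 1) * (?A gchoose j))"
    unfolding Suc_times_gbinomial ..
  also have "\<dots> = real (Suc n) * (real (Suc n) + \<alpha>) * coeff (monic_laguerre \<alpha> n) k"
    using n by (simp add: coeff_monic_laguerre \<sigma>_def)
  finally show ?thesis .
next
  case False
  thus ?thesis by (cases "k = Suc n") (simp_all add: coeff_monic_laguerre)
qed

text \<open>The two structure relations express \<open>x p\<^sub>n'\<close> by \<open>p\<^sub>n\<close> and one of its neighbours. Together they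
  imply the three-term recurrence and the Riccati equations for quotients of neighbours.
  On coefficients they are the absorption identity and Pascal's rule.\<close>

lemma pderiv_monic_laguerre_Suc:
  "pCons 0 (pderiv (monic_laguerre \<alpha> (Suc n))) =
     smult (real (Suc n)) (monic_laguerre \<alpha> (Suc n)) +
     smult (real (Suc n) * (real (Suc n) + \<alpha>)) (monic_laguerre \<alpha> n)"
  using coeff_monic_laguerre_degree_step[of _ n \<alpha>]
  by (intro poly_eqI) (simp add: coeff_pCons_0_pderiv algebra_simps del: of_nat_Suc)

lemma pderiv_monic_laguerre:
  "pCons 0 (pderiv (monic_laguerre \<alpha> n)) =
     [: - (real n + 1 + \<alpha>), 1 :] * monic_laguerre \<alpha> n - monic_laguerre \<alpha> (Suc n)"
proof (rule poly_eqI)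
  fix k
  let ?c = "\<lambda>n k. coeff (monic_laguerre \<alpha> n) k"
  have "real k * ?c n k = (if k = 0 then 0 else ?c n (k - 1)) - (real n + 1 + \<alpha>) * ?c n k - ?c (Suc n) k"
  proof (cases k)
    case 0
    have "real (Suc n) * - ?c (Suc n) 0 = real (Suc n) * ((real (Suc n) + \<alpha>) * ?c n 0)"
      using coeff_monic_laguerre_degree_step[of 0 n \<alpha>]
      by (simp add: algebra_simps del: of_nat_Suc)
    hence "- ?c (Suc n) 0 = (real (Suc n) + \<alpha>) * ?c n 0"
      by (subst (asm) mult_cancel_left) auto
    thus ?thesis using 0 by (simp add: algebra_simps)
  next
    case (Suc i)
    consider "k \<le> n" | "k = Suc n" | "k > Suc n" by linarith
    thus ?thesis
    proof cases
      case 1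
      then obtain j where n: "n = k + j" by (auto simp: le_iff_add)
      define A where "A = real n + \<alpha>"
      define G0 G1 \<sigma> where "G0 = (A gchoose j)" "G1 = (A gchoose Suc j)"
        and "\<sigma> = (-1) ^ (n + k) * fact n / (fact k :: real)"
      have pascal: "(A + 1 gchoose Suc j) = G0 + G1"
        by (simp add: G0_G1_def gbinomial_Suc_Suc)
      have absorb: "real (Suc j) * (G0 + G1) = (A + 1) * G0"
        using Suc_times_gbinomial[of j A] pascal by (simp add: G0_G1_def)
      have c1: "?c n k = \<sigma> * G0"
        using n by (simp add: coeff_monic_laguerre \<sigma>_def G0_G1_def A_def)
      have c2: "?c n i = - \<sigma> * real k * G1"
      proof -
        have "(fact k :: real) = real k * fact i" "real k \<noteq> 0" "i \<le> n" "n - i = Suc j"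
          "(-1 :: real) ^ (n + k) = - ((-1) ^ (n + i))"
          using n Suc by simp_all
        thus ?thesis by (simp add: coeff_monic_laguerre \<sigma>_def G0_G1_def A_def)
      qed
      have "?c (Suc n) k = - \<sigma> * real (Suc n) * (A + 1 gchoose Suc j)"
        using n by (simp add: coeff_monic_laguerre \<sigma>_def A_def fact_Suc Suc_diff_le
            add_ac mult_ac del: of_nat_Suc) (simp add: add_ac)
      also have "\<dots> = - \<sigma> * (real k * (G0 + G1) + real (Suc j) * (G0 + G1))"
        by (simp add: pascal n algebra_simps)
      finally have "?c (Suc n) k = - \<sigma> * (real k * (G0 + G1) + (A + 1) * G0)"
        unfolding absorb .
      thus ?thesis unfolding Suc using c1 c2 by (simp add: Suc A_def algebra_simps)
    next
      case 2
      thus ?thesis by (simp add: coeff_monic_laguerre power_add[symmetric] mult_2[symmetric])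
    next
      case 3
      thus ?thesis by (auto simp add: coeff_monic_laguerre)
    qed
  qed
  thus "coeff (pCons 0 (pderiv (monic_laguerre \<alpha> n))) k =
      coeff ([: - (real n + 1 + \<alpha>), 1 :] * monic_laguerre \<alpha> n - monic_laguerre \<alpha> (Suc n)) k"
    unfolding coeff_pCons_0_pderiv by (cases k) (simp_all add: coeff_pCons algebra_simps)
qed

lemma monic_laguerre_0: "monic_laguerre \<alpha> 0 = 1"
  by (simp add: monic_laguerre_def laguerre_def)

text \<open>For \<open>\<epsilon> = 1\<close> these are the monic Laguerre polynomials, for \<open>\<epsilon> = -1\<close> their reflections at the
  origin, again normalised to leading coefficient \<open>1\<close>. The sign is a parameter so that both
  extreme zeros are treated by the same computation.\<close>

definition signed_laguerre :: "real \<Rightarrow> real \<Rightarrow> nat \<Rightarrow> real \<Rightarrow> real" where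
  "signed_laguerre \<alpha> \<epsilon> k x = \<epsilon> ^ k * poly (monic_laguerre \<alpha> k) (\<epsilon> * x)"

lemma signed_laguerre_0 [simp]: "signed_laguerre \<alpha> \<epsilon> 0 x = 1"
  by (simp add: signed_laguerre_def monic_laguerre_0)

definition signed_laguerre' :: "real \<Rightarrow> real \<Rightarrow> nat \<Rightarrow> real \<Rightarrow> real" where
  "signed_laguerre' \<alpha> \<epsilon> k x = \<epsilon> ^ Suc k * poly (pderiv (monic_laguerre \<alpha> k)) (\<epsilon> * x)"

lemma signed_laguerre_has_derivative:
  "(signed_laguerre \<alpha> \<epsilon> k has_real_derivative
     signed_laguerre' \<alpha> \<epsilon> k x) (at x)"
  unfolding signed_laguerre_def[abs_def] signed_laguerre'_def
  by (rule derivative_eq_intros DERIV_chain'[of "\<lambda>x. \<epsilon> * x"] poly_DERIV refl | simp)+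

lemma signed_laguerre'_Suc:
  assumes "\<epsilon>\<^sup>2 = 1"
  shows "x * signed_laguerre' \<alpha> \<epsilon> (Suc n) x = real (Suc n) * signed_laguerre \<alpha> \<epsilon> (Suc n) x
    + \<epsilon> * (real (Suc n) * (real (Suc n) + \<alpha>)) * signed_laguerre \<alpha> \<epsilon> n x"
proof -
  have "(\<epsilon> * x) * poly (pderiv (monic_laguerre \<alpha> (Suc n))) (\<epsilon> * x) =
     real (Suc n) * poly (monic_laguerre \<alpha> (Suc n)) (\<epsilon> * x) +
     real (Suc n) * (real (Suc n) + \<alpha>) * poly (monic_laguerre \<alpha> n) (\<epsilon> * x)"
    using arg_cong[OF pderiv_monic_laguerre_Suc[of \<alpha> n], of "\<lambda>p. poly p (\<epsilon> * x)"] by simp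
  hence "\<epsilon> ^ Suc n * ((\<epsilon> * x) * poly (pderiv (monic_laguerre \<alpha> (Suc n))) (\<epsilon> * x)) =
     \<epsilon> ^ Suc n * (real (Suc n) * poly (monic_laguerre \<alpha> (Suc n)) (\<epsilon> * x) +
     real (Suc n) * (real (Suc n) + \<alpha>) * poly (monic_laguerre \<alpha> n) (\<epsilon> * x))" by simp
  thus ?thesis
    by (simp add: signed_laguerre'_def signed_laguerre_def algebra_simps)
qed

lemma signed_laguerre':
  assumes "\<epsilon>\<^sup>2 = 1"
  shows "x * signed_laguerre' \<alpha> \<epsilon> n x = (\<epsilon> * x - (real n + 1 + \<alpha>)) * signed_laguerre \<alpha> \<epsilon> n x
    - \<epsilon> * signed_laguerre \<alpha> \<epsilon> (Suc n) x"
proof -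
  have "(\<epsilon> * x) * poly (pderiv (monic_laguerre \<alpha> n)) (\<epsilon> * x) =
     (\<epsilon> * x - (real n + 1 + \<alpha>)) * poly (monic_laguerre \<alpha> n) (\<epsilon> * x) -
     poly (monic_laguerre \<alpha> (Suc n)) (\<epsilon> * x)"
    using arg_cong[OF pderiv_monic_laguerre[of \<alpha> n], of "\<lambda>p. poly p (\<epsilon> * x)"]
    by (simp add: algebra_simps)
  hence **: "\<epsilon> ^ n * ((\<epsilon> * x) * poly (pderiv (monic_laguerre \<alpha> n)) (\<epsilon> * x)) =
     \<epsilon> ^ n * ((\<epsilon> * x - (real n + 1 + \<alpha>)) * poly (monic_laguerre \<alpha> n) (\<epsilon> * x) -
     poly (monic_laguerre \<alpha> (Suc n)) (\<epsilon> * x))" by simp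
  have *: "\<epsilon> * (\<epsilon> * z) = z" for z
    using assms by (simp add: power2_eq_square flip: mult.assoc)
  show ?thesis
    using ** by (simp add: * signed_laguerre'_def signed_laguerre_def algebra_simps)
qed

text \<open>Eliminating the derivative from the two structure relations at the same index.\<close>

lemma signed_laguerre_rec:
  assumes "\<epsilon>\<^sup>2 = 1"
  shows "signed_laguerre \<alpha> \<epsilon> (Suc (Suc n)) x =
     (x - \<epsilon> * (2 * real (Suc n) + \<alpha> + 1)) * signed_laguerre \<alpha> \<epsilon> (Suc n) x
     - real (Suc n) * (real (Suc n) + \<alpha>) * signed_laguerre \<alpha> \<epsilon> n x"
proof -
  let ?L = "signed_laguerre \<alpha> \<epsilon>"
  have "\<epsilon> * ?L (Suc (Suc n)) x = (\<epsilon> * x - (2 * real (Suc n) + \<alpha> + 1)) * ?L (Suc n) x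
     - \<epsilon> * (real (Suc n) * (real (Suc n) + \<alpha>)) * ?L n x"
    using signed_laguerre'[OF assms, of x \<alpha> "Suc n"] signed_laguerre'_Suc[OF assms, of x \<alpha> n]
    by (simp add: algebra_simps)
  hence "\<epsilon> * (\<epsilon> * ?L (Suc (Suc n)) x) = \<epsilon> * ((\<epsilon> * x - (2 * real (Suc n) + \<alpha> + 1)) * ?L (Suc n) x
     - \<epsilon> * (real (Suc n) * (real (Suc n) + \<alpha>)) * ?L n x)" by simp
  moreover have "\<epsilon> * (\<epsilon> * z) = z" for z
    using assms by (simp add: power2_eq_square flip: mult.assoc)
  ultimately show ?thesis by (simp add: right_diff_distrib left_diff_distrib mult.assoc)
qed

lemma signed_laguerre_1:
  assumes "\<epsilon>\<^sup>2 = 1"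
  shows "signed_laguerre \<alpha> \<epsilon> (Suc 0) x = x - \<epsilon> * (\<alpha> + 1)"
proof -
  have "\<epsilon> * signed_laguerre \<alpha> \<epsilon> (Suc 0) x = \<epsilon> * x - (\<alpha> + 1)"
    using signed_laguerre'[OF assms, of x \<alpha> 0]
    by (simp add: signed_laguerre'_def monic_laguerre_0)
  hence "\<epsilon> * (\<epsilon> * signed_laguerre \<alpha> \<epsilon> (Suc 0) x) = \<epsilon> * (\<epsilon> * x - (\<alpha> + 1))" by simp
  moreover have "\<epsilon> * (\<epsilon> * z) = z" for z
    using assms by (simp add: power2_eq_square flip: mult.assoc)
  ultimately show ?thesis by (simp add: right_diff_distrib)
qed

lemma monic_recurrence_signed_laguerre:
  assumes "\<epsilon>\<^sup>2 = 1" "\<alpha> > -1"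
  shows "monic_recurrence (signed_laguerre \<alpha> \<epsilon>) (\<lambda>k. \<epsilon> * (2 * real k + \<alpha> + 1))
     (\<lambda>k. real k * (real k + \<alpha>))"
  by unfold_locales
     (use assms in \<open>simp_all add: signed_laguerre_rec signed_laguerre_1\<close>)

section \<open>Location of the extreme zeros\<close>

locale laguerre_extremes =
  fixes \<alpha> :: real and m :: nat
  assumes alpha: "\<alpha> > -1" and m_ge_4: "4 \<le> m"
begin

definition a :: real where "a = 2 * real (Suc m) + \<alpha> + 1"
definition b :: real where "b = real (Suc m) * (real (Suc m) + \<alpha>)"
abbreviation L :: "real \<Rightarrow> nat \<Rightarrow> real \<Rightarrow> real" where "L \<equiv> signed_laguerre \<alpha>"

text \<open>The prefix \<open>up\<close> refers to the Laguerre polynomials themselves and thus to their largest zeros,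
  the prefix \<open>low\<close> to their reflections and thus to the smallest zeros.\<close>

sublocale up: monic_recurrence "signed_laguerre \<alpha> 1" "\<lambda>k. 1 * (2 * real k + \<alpha> + 1)"
    "\<lambda>k. real k * (real k + \<alpha>)"
  using alpha by (intro monic_recurrence_signed_laguerre) auto

sublocale low: monic_recurrence "signed_laguerre \<alpha> (-1)" "\<lambda>k. (-1) * (2 * real k + \<alpha> + 1)"
    "\<lambda>k. real k * (real k + \<alpha>)"
  using alpha by (intro monic_recurrence_signed_laguerre) auto

text \<open>The deformed polynomial with \<open>s = t\<^sup>2\<close> has the largest zero \<open>v s\<close> and the smallest zero
  \<open>- w s\<close>; the latter is handled through the reflected polynomials, so \<open>w\<close> is increasing too. Its
  distance from \<open>a\<close> is \<open>U = w s + a\<close>, that of the former is \<open>V = v s - a\<close>.\<close>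

definition v :: "real \<Rightarrow> real" where "v = up.deformed_zero m"
definition w :: "real \<Rightarrow> real" where "w = low.deformed_zero m"

lemma a_pos: "a > 0" and b_pos: "b > 0"
  using alpha by (auto simp: a_def b_def intro!: mult_pos_pos)

text \<open>If \<open>a\<close> were at or above the largest zero of \<open>p\<^sub>m\<^sub>+\<^sub>1\<close>, all \<open>p\<^sub>k(a)\<close> with \<open>k \<le> m + 1\<close> would be
  nonnegative, and positive for \<open>k \<le> m\<close>. But the last two steps of the recurrence, with
  coefficients \<open>a - d\<^sub>m = 2\<close> and
  \<open>a - d\<^sub>m\<^sub>-\<^sub>1 = 4\<close>, give \<open>p\<^sub>m\<^sub>+\<^sub>1(a) \<le> (8 - m (m + \<alpha>)) p\<^sub>m\<^sub>-\<^sub>1(a)\<close>, and \<open>m (m + \<alpha>) > 4 \<cdot> 3\<close>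
  for \<open>m \<ge> 4\<close>.\<close>

lemma a_less_up_top: "a < up.top_zero m"
proof (rule ccontr)
  assume "\<not> a < up.top_zero m"
  define A where "A = a"
  have le: "up.top_zero m \<le> A" using \<open>\<not> a < up.top_zero m\<close> by (simp add: A_def)
  obtain i where m: "m = Suc (Suc i)" using m_ge_4 by (cases m; cases "m - 1") auto
  have pos: "k \<le> m \<Longrightarrow> L 1 k A > 0" for k using up.P_pos[OF le] .
  have nonneg: "L 1 (Suc m) A \<ge> 0"
    using up.P_pos_strict[of m A "Suc m"] up.P_top[of m] le
    by (cases "up.top_zero m = A") auto
  have A: "A = 2 * real i + 7 + \<alpha>" unfolding A_def a_def using m by simp
  have e1: "L 1 (Suc m) A = 2 * L 1 m A - real m * (real m + \<alpha>) * L 1 (Suc i) A"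
    using up.P_rec[of "Suc i" A] m by (simp add: A algebra_simps)
  have e2: "L 1 m A = 4 * L 1 (Suc i) A - real (Suc i) * (real (Suc i) + \<alpha>) * L 1 i A"
    using up.P_rec[of "i" A] m by (simp add: A algebra_simps)
  have "0 \<le> real (Suc i) * (real (Suc i) + \<alpha>) * L 1 i A"
    using pos[of i] alpha m by (intro mult_nonneg_nonneg) auto
  hence "L 1 (Suc m) A \<le> (8 - real m * (real m + \<alpha>)) * L 1 (Suc i) A"
    using e1 e2 by (simp add: algebra_simps)
  moreover have "8 < real m * (real m + \<alpha>)"
  proof -
    have "4 * 3 \<le> real m * (real m + \<alpha>)"
      using m_ge_4 alpha by (intro mult_mono) auto
    thus ?thesis by simp
  qed
  ultimately show False
    using nonneg pos[of "Suc i"] m by (smt (verit) mult_pos_pos mult_minus_left Suc_n_not_le_n nat_le_linear)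
qed

lemma minus_a_less_low_top: "- a < low.top_zero m"
  using low.P_pos_top[of "Suc 0" m] m_ge_4 by (simp add: low.P_1 a_def)

lemma up_gap: "1 * (2 * real (Suc m) + \<alpha> + 1) < up.top_zero m"
  using a_less_up_top by (simp add: a_def)

lemma low_gap: "(-1) * (2 * real (Suc m) + \<alpha> + 1) < low.top_zero m"
  using minus_a_less_low_top by (simp add: a_def)

lemma v_ge: "0 \<le> s \<Longrightarrow> up.top_zero m \<le> v s"
  and up_level_v: "0 \<le> s \<Longrightarrow> up.level m (v s) = s"
  and v_0: "v 0 = up.top_zero m"
  and w_ge: "0 \<le> s \<Longrightarrow> low.top_zero m \<le> w s"
  and low_level_w: "0 \<le> s \<Longrightarrow> low.level m (w s) = s"
  and w_0: "w 0 = low.top_zero m"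
  and v_strict_mono: "0 \<le> s \<Longrightarrow> s < s' \<Longrightarrow> v s < v s'"
  and w_strict_mono: "0 \<le> s \<Longrightarrow> s < s' \<Longrightarrow> w s < w s'"
  and v_cont: "continuous_on {0..} v"
  and w_cont: "continuous_on {0..} w"
  unfolding v_def w_def
  using up.top_le_deformed_zero[of m s, OF up_gap] up.level_deformed_zero[of m s, OF up_gap]
    up.deformed_zero_0[of m, OF up_gap] low.top_le_deformed_zero[of m s, OF low_gap]
    low.level_deformed_zero[of m s, OF low_gap] low.deformed_zero_0[of m, OF low_gap]
    up.deformed_zero_strict_mono[of m s s', OF up_gap] low.deformed_zero_strict_mono[of m s s', OF low_gap]
    up.continuous_deformed_zero[OF up_gap] low.continuous_deformed_zero[OF low_gap]
  by auto

lemma up_level_eq: "up.level m = (\<lambda>x. (x - a) * (L 1 (Suc m) x / L 1 m x) / b)"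
  unfolding up.level_def[abs_def] up.ratio_def[abs_def] a_def b_def by simp

lemma low_level_eq: "low.level m = (\<lambda>x. (x + a) * (L (-1) (Suc m) x / L (-1) m x) / b)"
  unfolding low.level_def[abs_def] low.ratio_def[abs_def] a_def b_def by (simp add: algebra_simps)

lemma V_pos: "0 \<le> s \<Longrightarrow> 0 < v s - a"
  using v_ge[of s] a_less_up_top by auto

lemma U_pos: "0 \<le> s \<Longrightarrow> 0 < w s + a"
  using w_ge[of s] minus_a_less_low_top by auto

lemma low_pos_at_0_Suc: "L (-1) (Suc k) 0 = (real (Suc k) + \<alpha>) * L (-1) k 0"
proof -
  have "real (Suc k) * L (-1) (Suc k) 0 = real (Suc k) * ((real (Suc k) + \<alpha>) * L (-1) k 0)"
    using signed_laguerre'_Suc[of "-1" 0 \<alpha> k] by (simp add: algebra_simps)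
  thus ?thesis by (subst (asm) mult_cancel_left) auto
qed

lemma low_pos_at_0: "L (-1) k 0 > 0"
proof (induction k)
  case (Suc k)
  thus ?case using low_pos_at_0_Suc[of k] alpha by (auto intro!: mult_pos_pos)
qed auto

text \<open>The smallest zero stays positive up to \<open>s = 1\<close>, because the level of the origin is
  \<open>a / (m + 1) > 1\<close>.\<close>

lemma w_neg:
  assumes "0 \<le> s" "s \<le> 1"
  shows "w s < 0"
proof (rule ccontr)
  assume "\<not> w s < 0"
  have top: "low.top_zero m < 0"
  proof (rule ccontr)
    assume "\<not> low.top_zero m < 0"
    hence "L (-1) (Suc m) (low.top_zero m) > 0"
      using low.pos_above[of "Suc m" 0 "low.top_zero m" "Suc m"] low_pos_at_0 by auto
    thus False by (simp add: low.P_top)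
  qed
  have "low.level m 0 \<le> low.level m (w s)"
    using low.level_le_iff[OF low_gap, of 0 "w s"] top w_ge[OF assms(1)] \<open>\<not> w s < 0\<close> by simp
  also have "\<dots> \<le> 1" using low_level_w assms by simp
  finally have "low.level m 0 \<le> 1" .
  moreover have "low.ratio m 0 = real (Suc m) + \<alpha>"
    using low_pos_at_0[of m] by (simp add: low.ratio_def low_pos_at_0_Suc)
  hence "low.level m 0 = a / real (Suc m)"
    using alpha unfolding low_level_eq by (simp add: low.ratio_def b_def)
  moreover have "a / real (Suc m) > 1" using alpha by (simp add: a_def field_simps)
  ultimately show False by simp
qed

text \<open>Were \<open>U \<le> V\<close>, the point \<open>y = - a + V\<close> would lie at or to the right of \<open>w s\<close>, so the ratio of the
  reflected sequence at \<open>w s\<close> would be at most that at \<open>y\<close>, which by Perron's comparison is less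
  than the ratio of the original sequence at \<open>a + V = v s\<close>. This is incompatible with \<open>U \<le> V\<close>,
  since \<open>U\<close> times the first ratio and \<open>V\<close> times the last one are both equal to \<open>s b\<close>.\<close>

lemma V_less_U:
  assumes s: "0 \<le> s"
  shows "v s - a < w s + a"
proof (rule ccontr)
  assume "\<not> v s - a < w s + a"
  define y where "y = v s - 2 * a"
  have wy: "w s \<le> y" using \<open>\<not> v s - a < w s + a\<close> by (simp add: y_def)
  have posw: "\<forall>k\<le>m. L (-1) k (w s) > 0" using low.P_pos[OF w_ge[OF s]] by blast
  have "L (-1) (Suc m) y / L (-1) m y < L 1 (Suc m) (v s) / L 1 m (v s)"
  proof (rule ratio_less_ratio[OF up.monic_recurrence_axioms low.monic_recurrence_axioms])
    show "\<forall>k\<le>m. L 1 k (v s) > 0" using up.P_pos[OF v_ge[OF s]] by blast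
    show "\<forall>k\<le>m. L (-1) k y > 0" using low.pos_above[of m "w s" y] posw wy by blast
  qed (auto simp: y_def a_def)
  hence "low.ratio m y < up.ratio m (v s)" by (simp add: up.ratio_def low.ratio_def)
  moreover have "low.ratio m (w s) \<le> low.ratio m y"
    using low.ratio_growth[OF posw wy] wy by simp
  ultimately have r: "low.ratio m (w s) < up.ratio m (v s)" by simp
  have "(w s + a) * low.ratio m (w s) < (v s - a) * up.ratio m (v s)"
    using r wy V_pos[OF s] U_pos[OF s] low.ratio_nonneg[OF w_ge[OF s]]
    by (intro mult_le_less_imp_less) (auto simp: y_def)
  moreover have "(w s + a) * low.ratio m (w s) / b = (v s - a) * up.ratio m (v s) / b"
    using low_level_w[OF s] up_level_v[OF s]
    unfolding low_level_eq up_level_eq by (simp add: low.ratio_def up.ratio_def)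
  ultimately show False using b_pos by auto
qed

section \<open>Motion of the extreme zeros\<close>

text \<open>After the derivatives are replaced by means of the structure relations, the derivative of
  the level \<open>S\<close> is a polynomial in the ratio \<open>r = P / Q\<close>, and \<open>r = S b / Z\<close> expresses it by \<open>S\<close> and
  \<open>x\<close> alone.\<close>

lemma level_has_derivative:
  fixes \<epsilon> x :: real
  assumes \<epsilon>: "\<epsilon>\<^sup>2 = 1" and nz: "L \<epsilon> m x \<noteq> 0" "x \<noteq> 0" "x - \<epsilon> * a \<noteq> 0"
  defines "S \<equiv> \<lambda>x. (x - \<epsilon> * a) * (L \<epsilon> (Suc m) x / L \<epsilon> m x) / b"
  shows "(S has_real_derivative
     ((x - \<epsilon> * a)\<^sup>2 * (1 - S x) + a * S x + b * (S x)\<^sup>2) / (\<epsilon> * (x - \<epsilon> * a) * x)) (at x)"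
proof -
  define P Q where "P = L \<epsilon> (Suc m) x" and "Q = L \<epsilon> m x"
  define P' Q' where "P' = signed_laguerre' \<alpha> \<epsilon> (Suc m) x" and "Q' = signed_laguerre' \<alpha> \<epsilon> m x"
  define Z where "Z = x - \<epsilon> * a"
  define A where "A = a"
  define B where "B = b"
  define N where "N = real (Suc m)"
  have AN: "A = 2 * N + \<alpha> + 1" by (simp add: A_def N_def a_def)
  have e1: "\<epsilon> * \<epsilon> = 1" using \<epsilon> by (simp add: power2_eq_square)
  have B0: "B \<noteq> 0" using b_pos unfolding B_def by linarith
  have Q0: "Q \<noteq> 0" and x0: "x \<noteq> 0" and Z0: "Z \<noteq> 0" and \<epsilon>0: "\<epsilon> \<noteq> 0"
    using nz \<epsilon> by (auto simp: Q_def Z_def)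
  have P': "x * P' = N * P + \<epsilon> * B * Q"
    using signed_laguerre'_Suc[OF \<epsilon>, of x \<alpha> m] by (simp only: P_def Q_def P'_def N_def B_def b_def)
  have Q': "x * Q' = (\<epsilon> * x - (N + \<alpha>)) * Q - \<epsilon> * P"
    using signed_laguerre'[OF \<epsilon>, of x \<alpha> m] 
    by (simp add: P_def Q_def Q'_def N_def algebra_simps)
  have dP: "(L \<epsilon> (Suc m) has_real_derivative P') (at x)"
    and dQ: "(L \<epsilon> m has_real_derivative Q') (at x)"
    using signed_laguerre_has_derivative[of \<alpha> \<epsilon> "Suc m" x] signed_laguerre_has_derivative[of \<alpha> \<epsilon> m x]
    by (simp_all only: P'_def Q'_def)
  have S: "S x = Z * P / (B * Q)"
    by (simp only: S_def Z_def P_def Q_def B_def times_divide_eq_right divide_divide_eq_left mult.commute[of "L \<epsilon> m x"])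
  have "((\<lambda>x. (x - \<epsilon> * A) * (L \<epsilon> (Suc m) x / L \<epsilon> m x) / B) has_real_derivative
      (1 * (P / Q) + (P' * Q - P * Q') / (Q * Q) * Z) / B) (at x)"
    by (rule derivative_eq_intros dP dQ refl | (simp add: P_def Q_def Z_def A_def nz B0))+
  moreover have "(1 * (P / Q) + (P' * Q - P * Q') / (Q * Q) * Z) / B =
    (Z\<^sup>2 * (1 - S x) + A * S x + B * (S x)\<^sup>2) / (\<epsilon> * Z * x)"
  proof -
    have x: "x = Z + \<epsilon> * A" by (simp add: Z_def A_def)
    define r where "r = P / Q"
    have P: "P = r * Q" using Q0 by (simp add: r_def)
    have "x * (1 * (P / Q) + (P' * Q - P * Q') / (Q * Q) * Z) =
       x * r + ((x * P') * Q - P * (x * Q')) / (Q * Q) * Z"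
      using Q0 by (simp add: field_simps P)
    also have "((x * P') * Q - P * (x * Q')) / (Q * Q) =
        N * r + \<epsilon> * B - r * (\<epsilon> * x - (N + \<alpha>)) + \<epsilon> * r\<^sup>2"
      unfolding P' Q' P using Q0 by (simp add: field_simps power2_eq_square)
    finally have lhs: "x * (1 * (P / Q) + (P' * Q - P * Q') / (Q * Q) * Z) = 
       x * r + (N * r + \<epsilon> * B - r * (\<epsilon> * x - (N + \<alpha>)) + \<epsilon> * r\<^sup>2) * Z" .
    have "\<epsilon> * (x * r + (N * r + \<epsilon> * B - r * (\<epsilon> * x - (N + \<alpha>)) + \<epsilon> * r\<^sup>2) * Z) =
        \<epsilon> * x * r + (\<epsilon> * N * r + (\<epsilon> * \<epsilon>) * B - r * ((\<epsilon> * \<epsilon>) * x - \<epsilon> * (N + \<alpha>)) + (\<epsilon> * \<epsilon>) * r\<^sup>2) * Z"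
      by (simp add: algebra_simps)
    also have "\<dots> = (\<epsilon> * Z + A) * r + (\<epsilon> * N * r + (\<epsilon> * \<epsilon>) * B - r * ((\<epsilon> * \<epsilon>) * x - \<epsilon> * (N + \<alpha>)) + (\<epsilon> * \<epsilon>) * r\<^sup>2) * Z"
    proof -
      have "\<epsilon> * x = \<epsilon> * Z + (\<epsilon> * \<epsilon>) * A" by (simp add: x algebra_simps)
      thus ?thesis by (simp add: e1)
    qed
    also have "\<dots> = B * Z - r * Z\<^sup>2 + A * r + r\<^sup>2 * Z"
      unfolding e1 x by (simp add: AN algebra_simps power2_eq_square)
    finally have eq: "\<epsilon> * (x * (1 * (P / Q) + (P' * Q - P * Q') / (Q * Q) * Z)) =
       B * Z - r * Z\<^sup>2 + A * r + r\<^sup>2 * Z" unfolding lhs .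
    have S': "S x = Z * r / B" unfolding S r_def using Q0 B0 by simp
    have "Z\<^sup>2 * (1 - S x) + A * S x + B * (S x)\<^sup>2 = (B * Z - r * Z\<^sup>2 + A * r + r\<^sup>2 * Z) * Z / B"
      unfolding S' using B0 by (simp add: field_simps power2_eq_square)
    hence "(Z\<^sup>2 * (1 - S x) + A * S x + B * (S x)\<^sup>2) / (\<epsilon> * Z * x) =
      (\<epsilon> * (x * (1 * (P / Q) + (P' * Q - P * Q') / (Q * Q) * Z))) * Z / B / (\<epsilon> * Z * x)"
      unfolding eq by simp
    also have "\<dots> = (1 * (P / Q) + (P' * Q - P * Q') / (Q * Q) * Z) / B"
    proof -
      define T where "T = 1 * (P / Q) + (P' * Q - P * Q') / (Q * Q) * Z"
      have "(\<epsilon> * (x * T)) * Z / B / (\<epsilon> * Z * x) = T / B" using \<epsilon>0 Z0 x0 by simp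
      thus ?thesis unfolding T_def .
    qed
    finally show ?thesis ..
  qed
  ultimately show ?thesis unfolding Z_def S_def A_def B_def by simp
qed

definition c :: "real \<Rightarrow> real" where "c s = a * s + b * s\<^sup>2"

lemma c_pos: "0 < s \<Longrightarrow> c s > 0"
  unfolding c_def using a_pos b_pos by (intro add_pos_pos mult_pos_pos) auto

text \<open>The equation of motion, by the inverse function rule.\<close>

lemma zero_has_derivative:
  fixes \<epsilon> :: real and z S :: "real \<Rightarrow> real"
  defines "S \<equiv> \<lambda>x. (x - \<epsilon> * a) * (L \<epsilon> (Suc m) x / L \<epsilon> m x) / b"
  assumes \<epsilon>: "\<epsilon>\<^sup>2 = 1" and s: "0 < s" "s < 1"
    and nz: "L \<epsilon> m (z s) \<noteq> 0" "z s \<noteq> 0" "z s - \<epsilon> * a \<noteq> 0"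
    and inv: "\<And>t. 0 \<le> t \<Longrightarrow> S (z t) = t" and cont: "continuous_on {0..} z"
  shows "(z has_real_derivative
     \<epsilon> * (z s - \<epsilon> * a) * z s / ((z s - \<epsilon> * a)\<^sup>2 * (1 - s) + c s)) (at s)"
proof -
  define Z where "Z = z s - \<epsilon> * a"
  define D where "D = (Z\<^sup>2 * (1 - s) + c s) / (\<epsilon> * Z * z s)"
  have "Z\<^sup>2 * (1 - s) \<ge> 0" using s by simp
  hence num: "Z\<^sup>2 * (1 - s) + c s > 0" using c_pos[OF s(1)] by linarith
  have Ss: "S (z s) = s" using inv s by simp
  have "(S has_real_derivative D) (at (z s))"
    using level_has_derivative[OF \<epsilon> nz, folded S_def, unfolded Ss[unfolded S_def]]
    by (simp add: Z_def D_def c_def add.assoc)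
  moreover have "D \<noteq> 0" using num nz \<epsilon> by (auto simp: D_def Z_def)
  moreover have "isCont z s"
  proof -
    have "continuous_on {0<..} z" by (rule continuous_on_subset[OF cont]) auto
    thus ?thesis using s by (simp add: continuous_on_eq_continuous_at)
  qed
  ultimately have "(z has_real_derivative inverse D) (at s)"
    using DERIV_inverse_function[of S D z s 0 1] inv s by auto
  thus ?thesis by (simp add: D_def Z_def)
qed

lemma v_pos: "0 \<le> s \<Longrightarrow> 0 < v s"
  using V_pos[of s] a_pos by auto

lemma v_has_derivative:
  assumes s: "0 < s" "s < 1"
  shows "(v has_real_derivative (v s - a) * v s / ((v s - a)\<^sup>2 * (1 - s) + c s)) (at s)"
proof -
  have "L 1 m (v s) > 0" using up.P_pos[OF v_ge] s by simp
  from zero_has_derivative[of 1 s v] this v_pos[of s] V_pos[of s] up_level_v v_cont s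
  show ?thesis unfolding up_level_eq by simp
qed

lemma w_has_derivative:
  assumes s: "0 < s" "s < 1"
  shows "(w has_real_derivative - (w s + a) * w s / ((w s + a)\<^sup>2 * (1 - s) + c s)) (at s)"
proof -
  have "L (-1) m (w s) > 0" using low.P_pos[OF w_ge] s by simp
  from zero_has_derivative[of "-1" s w] this w_neg[of s] U_pos[of s] low_level_w w_cont s
  show ?thesis unfolding low_level_eq by simp
qed

section \<open>The product of the extreme zeros is unimodal\<close>

definition zero_prod :: "real \<Rightarrow> real" where "zero_prod s = - w s * v s"

text \<open>The derivative of the product is a positive multiple of this quantity.\<close>

definition balance :: "real \<Rightarrow> real" where "balance s = (w s + a) * (v s - a) * (1 - s) - c s"

lemma continuous_zero_prod: "continuous_on {0..1} zero_prod"
  unfolding zero_prod_def[abs_def]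
  by (intro continuous_intros continuous_on_subset[OF v_cont] continuous_on_subset[OF w_cont]) auto

lemma continuous_balance: "continuous_on {0..1} balance"
  unfolding balance_def[abs_def] c_def[abs_def]
  by (intro continuous_intros continuous_on_subset[OF v_cont] continuous_on_subset[OF w_cont]) auto

lemma denominator_pos: 
  assumes "0 < s" "s < 1"
  shows "X\<^sup>2 * (1 - s) + c s > 0"
proof -
  have "X\<^sup>2 * (1 - s) \<ge> 0" using assms by simp
  thus ?thesis using c_pos[OF assms(1)] by linarith
qed

lemma zero_prod_has_derivative:
  assumes s: "0 < s" "s < 1"
  shows "\<exists>k>0. (zero_prod has_real_derivative k * balance s) (at s)"
proof -
  define U V where "U = w s + a" and "V = v s - a"
  define DU DV where "DU = U\<^sup>2 * (1 - s) + c s" and "DV = V\<^sup>2 * (1 - s) + c s"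
  have D: "DU > 0" "DV > 0" using denominator_pos[OF s] by (simp_all add: DU_def DV_def)
  have "(zero_prod has_real_derivative
      - (- U * w s / DU * v s + V * v s / DV * w s)) (at s)"
    unfolding zero_prod_def[abs_def]
    by (rule derivative_eq_intros v_has_derivative[OF s] w_has_derivative[OF s] refl |
        simp add: U_def V_def DU_def DV_def)+
  also have "- (- U * w s / DU * v s + V * v s / DV * w s) =
      - w s * v s / (DU * DV) * (V * DU - U * DV)"
    using D by (simp add: field_simps)
  also have "V * DU - U * DV = (U - V) * (U * V * (1 - s) - c s)"
    by (simp add: DU_def DV_def algebra_simps power2_eq_square)
  also have "U * V * (1 - s) - c s = balance s" by (simp only: balance_def U_def V_def)
  finally have "(zero_prod has_real_derivative - w s * v s / (DU * DV) * (U - V) * balance s) (at s)"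
    by (simp add: mult.assoc)
  moreover have "- w s * v s / (DU * DV) * (U - V) > 0"
    using D w_neg[of s] v_pos[of s] V_less_U[of s] s
    by (intro mult_pos_pos divide_pos_pos) (auto simp: U_def V_def)
  ultimately show ?thesis by blast
qed

text \<open>At a zero, \<open>c s = U V (1 - s)\<close> simplifies both denominators of the equations of motion to
  multiples of \<open>(1 - s) (U + V)\<close>, and \<open>(a - U) V + (a + V) U = a (U + V)\<close> cancels this factor. The
  derivative that remains is \<open>- U V - 2 b s\<close>.\<close>

lemma balance_decreasing_at_zero:
  assumes s: "0 < s" "s < 1" and zero: "balance s = 0"
  shows "\<exists>D<0. (balance has_real_derivative D) (at s)"
proof -
  define U V K where "U = w s + a" and "V = v s - a" and "K = 1 - s"
  have pos: "U > 0" "V > 0" "K > 0" using U_pos[of s] V_pos[of s] s by (auto simp: U_def V_def K_def)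
  have c: "c s = U * V * K" using zero by (simp add: balance_def U_def V_def K_def)
  have "w s = U - a" "v s = a + V" by (simp_all add: U_def V_def)
  have dU: "- U * w s / (U\<^sup>2 * (1 - s) + c s) = (a - U) / (K * (U + V))"
  proof -
    have "U\<^sup>2 * (1 - s) + c s = U * (K * (U + V))"
      by (simp add: c K_def[symmetric] power2_eq_square algebra_simps)
    moreover have "- U * w s = U * (a - U)" by (simp add: \<open>w s = U - a\<close> algebra_simps)
    ultimately show ?thesis using pos by simp
  qed
  have dV: "V * v s / (V\<^sup>2 * (1 - s) + c s) = (a + V) / (K * (U + V))"
  proof -
    have "V\<^sup>2 * (1 - s) + c s = V * (K * (U + V))"
      by (simp add: c K_def[symmetric] power2_eq_square algebra_simps)
    thus ?thesis using pos by (simp add: \<open>v s = a + V\<close>)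
  qed
  have dw: "(w has_real_derivative (a - U) / (K * (U + V))) (at s)"
    using w_has_derivative[OF s, folded U_def] unfolding dU .
  have dv: "(v has_real_derivative (a + V) / (K * (U + V))) (at s)"
    using v_has_derivative[OF s, folded V_def] unfolding dV .
  have "(balance has_real_derivative
      ((a - U) / (K * (U + V)) * V + (a + V) / (K * (U + V)) * U) * K + - 1 * (U * V)
       - (a + b * (2 * s))) (at s)"
    unfolding balance_def[abs_def] c_def[abs_def]
    by (rule derivative_eq_intros dw dv refl | simp add: U_def V_def K_def)+
  also have "((a - U) / (K * (U + V)) * V + (a + V) / (K * (U + V)) * U) * K = a"
  proof -
    have "((a - U) / (K * (U + V)) * V + (a + V) / (K * (U + V)) * U) * K =
        ((a - U) * V + (a + V) * U) * K / (K * (U + V))"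
      by (simp only: times_divide_eq_left add_divide_distrib[symmetric])
    also have "((a - U) * V + (a + V) * U) * K = a * (K * (U + V))" by (simp add: algebra_simps)
    finally show ?thesis using pos by simp
  qed
  finally have "(balance has_real_derivative - (U * V) - 2 * b * s) (at s)" by (simp add: algebra_simps)
  moreover have "- (U * V) - 2 * b * s < 0"
    using mult_pos_pos[OF pos(1,2)] mult_pos_pos[OF b_pos s(1)] by simp
  ultimately show ?thesis by blast
qed

lemma zero_prod_unimodal:
  obtains s0 where "0 < s0" "s0 < 1"
    "\<And>x y. 0 \<le> x \<Longrightarrow> x < y \<Longrightarrow> y \<le> s0 \<Longrightarrow> zero_prod x < zero_prod y"
    "\<And>x y. s0 \<le> x \<Longrightarrow> x < y \<Longrightarrow> y \<le> 1 \<Longrightarrow> zero_prod y < zero_prod x"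
proof -
  have balance_0: "balance 0 > 0" using U_pos[of 0] V_pos[of 0] by (simp add: balance_def c_def)
  have balance_1: "balance 1 < 0" using c_pos[of 1] by (simp add: balance_def)
  obtain s0 where s0: "0 < s0" "s0 < 1"
    "\<And>x. 0 \<le> x \<Longrightarrow> x < s0 \<Longrightarrow> balance x > 0" "\<And>x. s0 < x \<Longrightarrow> x \<le> 1 \<Longrightarrow> balance x < 0"
    by (rule unique_sign_change_if_decreasing_at_zeros[OF zero_less_one continuous_balance balance_0 balance_1])
      (use balance_decreasing_at_zero in blast)+
  show ?thesis
  proof (rule that[OF s0(1,2)])
    show "zero_prod x < zero_prod y" if "0 \<le> x" "x < y" "y \<le> s0" for x y
    proof (rule DERIV_pos_imp_increasing_open[OF that(2)])
      fix s assume s: "x < s" "s < y"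
      with that s0 zero_prod_has_derivative[of s] obtain k 
        where "k > 0" "(zero_prod has_real_derivative k * balance s) (at s)" by auto
      thus "\<exists>D. (zero_prod has_real_derivative D) (at s) \<and> 0 < D" using s0(3)[of s] s that by auto
    qed (use that s0 in \<open>auto intro: continuous_on_subset[OF continuous_zero_prod]\<close>)
    show "zero_prod y < zero_prod x" if "s0 \<le> x" "x < y" "y \<le> 1" for x y
    proof (rule DERIV_neg_imp_decreasing_open[OF that(2)])
      fix s assume s: "x < s" "s < y"
      with that s0 zero_prod_has_derivative[of s] obtain k 
        where "k > 0" "(zero_prod has_real_derivative k * balance s) (at s)" by auto
      thus "\<exists>D. (zero_prod has_real_derivative D) (at s) \<and> D < 0"
        using s0(4)[of s] s that by (auto simp: mult_pos_neg)
    qed (use that s0 in \<open>auto intro: continuous_on_subset[OF continuous_zero_prod]\<close>)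
  qed
qed

section \<open>Comparison of the endpoints\<close>

lemma up_next: "L 1 (Suc (Suc m)) y = (y - a) * L 1 (Suc m) y - b * L 1 m y"
  using up.P_rec[of m y] by (simp add: a_def b_def)

lemma low_next: "L (-1) (Suc (Suc m)) z = (z + a) * L (-1) (Suc m) z - b * L (-1) m z"
  using low.P_rec[of m z] by (simp add: a_def b_def algebra_simps)

lemma v_is_zero: "0 \<le> s \<Longrightarrow> (v s - a) * L 1 (Suc m) (v s) - s * b * L 1 m (v s) = 0"
  using up.deformed_zero_is_zero[OF up_gap, of s] by (simp add: v_def a_def b_def)

lemma zero_le_v: "0 \<le> s \<Longrightarrow> (x - a) * L 1 (Suc m) x - s * b * L 1 m x = 0 \<Longrightarrow> x \<le> v s"
  using up.zero_le_deformed_zero[OF up_gap, of s x] by (simp add: v_def a_def b_def)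

lemma w_is_zero: "0 \<le> s \<Longrightarrow> (w s + a) * L (-1) (Suc m) (w s) - s * b * L (-1) m (w s) = 0"
  using low.deformed_zero_is_zero[OF low_gap, of s] by (simp add: w_def a_def b_def algebra_simps)

lemma zero_le_w: "0 \<le> s \<Longrightarrow> (x + a) * L (-1) (Suc m) x - s * b * L (-1) m x = 0 \<Longrightarrow> x \<le> w s"
  using low.zero_le_deformed_zero[OF low_gap, of s x] by (simp add: w_def a_def b_def algebra_simps)

lemma up_next_neg:
  assumes "v 0 \<le> y" "y < v 1"
  shows "L 1 (Suc (Suc m)) y < 0"
proof -
  have pos: "L 1 m y > 0" using up.P_pos[of m y m] assms v_0 by simp
  have "up.level m y < up.level m (v 1)"
    using up.level_strict_mono[OF up_gap, of y "v 1"] assms v_0 by simp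
  also have "\<dots> = 1" by (rule up_level_v) simp
  finally have "(y - a) * (L 1 (Suc m) y / L 1 m y) / b < 1"
    unfolding up_level_eq .
  hence "(y - a) * (L 1 (Suc m) y / L 1 m y) < b" using b_pos by (simp only: divide_less_eq_1_pos)
  hence "(y - a) * L 1 (Suc m) y < b * L 1 m y" using pos by (simp add: field_simps)
  thus ?thesis by (simp add: up_next)
qed

text \<open>With \<open>q\<close> for the reflected and \<open>p\<close> for the original polynomials, \<open>H = q\<^sub>n p\<^sub>n\<^sub>+\<^sub>1 - q\<^sub>n\<^sub>+\<^sub>1 p\<^sub>n\<close>
  satisfies the linear equation \<open>H' = (a + 1 - y) H + q\<^sub>n p\<^sub>n\<^sub>+\<^sub>1 (y - z - 2 a - 2)\<close>; the exponential
  is its integrating factor. Working with \<open>H\<close> instead of the difference of the quotients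
  \<open>q\<^sub>n\<^sub>+\<^sub>1 / q\<^sub>n\<close> and \<open>p\<^sub>n\<^sub>+\<^sub>1 / p\<^sub>n\<close> allows either denominator to vanish at the end of the interval.\<close>

lemma cross_wronskian_derivative:
  fixes u1 v1 :: real
  defines "y \<equiv> \<lambda>\<theta>. v1 * exp (- \<theta>)" and "z \<equiv> \<lambda>\<theta>. u1 * exp \<theta>"
  defines "H \<equiv> \<lambda>\<theta>. L (-1) (Suc m) (z \<theta>) * L 1 (Suc (Suc m)) (y \<theta>)
                  - L (-1) (Suc (Suc m)) (z \<theta>) * L 1 (Suc m) (y \<theta>)"
  shows "((\<lambda>\<theta>. exp (- (a + 1) * \<theta> - y \<theta>) * H \<theta>) has_real_derivative
    exp (- (a + 1) * \<theta> - y \<theta>) * (L (-1) (Suc m) (z \<theta>) * L 1 (Suc (Suc m)) (y \<theta>)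
        * (y \<theta> - z \<theta> - 2 * a - 2))) (at \<theta>)"
proof -
  let ?P = "\<lambda>\<epsilon> k x. signed_laguerre' \<alpha> \<epsilon> k x"
  have dL: "(L \<epsilon> k has_real_derivative ?P \<epsilon> k x) (at x)" for \<epsilon> k x
    by (rule signed_laguerre_has_derivative)
  have dy: "(y has_real_derivative - y \<theta>) (at \<theta>)" and dz: "(z has_real_derivative z \<theta>) (at \<theta>)"
    unfolding y_def z_def by (auto intro!: derivative_eq_intros)
  have dLy: "((\<lambda>\<theta>. L 1 k (y \<theta>)) has_real_derivative - (y \<theta> * ?P 1 k (y \<theta>))) (at \<theta>)" for k
    using DERIV_chain2[OF dL dy, of 1 k] by (simp add: mult.commute)
  have dLz: "((\<lambda>\<theta>. L (-1) k (z \<theta>)) has_real_derivative z \<theta> * ?P (-1) k (z \<theta>)) (at \<theta>)" for k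
    using DERIV_chain2[OF dL dz, of "-1" k] by (simp add: mult.commute)
  define Y Z where "Y = y \<theta>" and "Z = z \<theta>"
  define p pN q qN where "p = L 1 (Suc m) Y" and "pN = L 1 (Suc (Suc m)) Y"
    and "q = L (-1) (Suc m) Z" and "qN = L (-1) (Suc (Suc m)) Z"
  define N where "N = real (Suc (Suc m))"
  have a: "a + 1 = 2 * N + \<alpha>" by (simp add: a_def N_def)
  have p': "Y * ?P 1 (Suc m) Y = (Y - (N + \<alpha>)) * p - pN"
    using signed_laguerre'[of 1 Y \<alpha> "Suc m"] by (simp add: p_def pN_def N_def algebra_simps)
  have pN': "Y * ?P 1 (Suc (Suc m)) Y = N * pN + N * (N + \<alpha>) * p"
    using signed_laguerre'_Suc[of 1 Y \<alpha> "Suc m"] by (simp add: p_def pN_def N_def algebra_simps)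
  have q': "Z * ?P (-1) (Suc m) Z = (- Z - (N + \<alpha>)) * q + qN"
    using signed_laguerre'[of "-1" Z \<alpha> "Suc m"] by (simp add: q_def qN_def N_def algebra_simps)
  have qN': "Z * ?P (-1) (Suc (Suc m)) Z = N * qN - N * (N + \<alpha>) * q"
    using signed_laguerre'_Suc[of "-1" Z \<alpha> "Suc m"] by (simp add: q_def qN_def N_def algebra_simps)
  define E where "E = (\<lambda>\<theta>. exp (- (a + 1) * \<theta> - y \<theta>))"
  have dE: "(E has_real_derivative E \<theta> * (Y - (a + 1))) (at \<theta>)"
    unfolding E_def by (rule derivative_eq_intros dy refl | simp add: Y_def)+
  have "((\<lambda>\<theta>. E \<theta> * H \<theta>) has_real_derivative
     E \<theta> * (Y - (a + 1)) * (q * pN - qN * p) +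
     (((- Z - (N + \<alpha>)) * q + qN) * pN + - ((N * pN + N * (N + \<alpha>) * p)) * q
      - ((N * qN - N * (N + \<alpha>) * q) * p + - ((Y - (N + \<alpha>)) * p - pN) * qN)) * E \<theta>) (at \<theta>)"
    unfolding H_def
    by (rule derivative_eq_intros dE dLy dLz refl |
        simp add: Y_def[symmetric] Z_def[symmetric] p' pN' q' qN' p_def[symmetric] pN_def[symmetric]
          q_def[symmetric] qN_def[symmetric])+
  also have "E \<theta> * (Y - (a + 1)) * (q * pN - qN * p) +
     (((- Z - (N + \<alpha>)) * q + qN) * pN + - ((N * pN + N * (N + \<alpha>) * p)) * q
      - ((N * qN - N * (N + \<alpha>) * q) * p + - ((Y - (N + \<alpha>)) * p - pN) * qN)) * E \<theta>
    = E \<theta> * (q * pN * (Y - Z - 2 * (a + 1)))"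
    unfolding a by (simp add: algebra_simps)
  finally show ?thesis by (simp add: E_def q_def pN_def Y_def Z_def algebra_simps)
qed

text \<open>If the claim failed, \<open>y\<close> would reach the largest zero \<open>v 0\<close> of \<open>p\<^sub>n\<close>, at the time \<open>\<tau>\<close>, no later than
  \<open>z\<close> reaches \<open>w 0\<close>. Up to then \<open>H\<close> times the integrating factor increases strictly from \<open>0\<close>,
  but at \<open>\<tau>\<close> it is at most \<open>0\<close>.\<close>

lemma zero_prod_0_less_zero_prod_1: "zero_prod 0 < zero_prod 1"
proof (rule ccontr)
  assume "\<not> zero_prod 0 < zero_prod 1"
  hence le: "- w 1 * v 1 \<le> - w 0 * v 0" by (simp add: zero_prod_def)
  define \<tau> where "\<tau> = ln (v 1 / v 0)"
  have v: "0 < v 0" "v 0 < v 1" using v_pos[of 0] v_strict_mono[of 0 1] by auto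
  have w: "w 0 < w 1" "w 0 < 0" "w 1 < 0" using w_neg[of 0] w_neg[of 1] w_strict_mono[of 0 1] by auto
  have \<tau>: "0 < \<tau>" "exp \<tau> = v 1 / v 0" "exp (- \<tau>) = v 0 / v 1"
    using v by (auto simp: \<tau>_def exp_minus)
  have wv: "- w 0 < v 0" using U_pos[of 0] V_pos[of 0] by auto
  define y z where "y = (\<lambda>\<theta>. v 1 * exp (- \<theta>))" and "z = (\<lambda>\<theta>. w 1 * exp \<theta>)"
  define F where "F = (\<lambda>\<theta>. exp (- (a + 1) * \<theta> - y \<theta>) *
    (L (-1) (Suc m) (z \<theta>) * L 1 (Suc (Suc m)) (y \<theta>)
      - L (-1) (Suc (Suc m)) (z \<theta>) * L 1 (Suc m) (y \<theta>)))"
  have y_0: "y 0 = v 1" by (simp add: y_def)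
  have y_\<tau>: "y \<tau> = v 0" using v by (simp add: y_def \<tau>)
  have z_\<tau>: "w 0 \<le> z \<tau>" using le v by (simp add: z_def \<tau> field_simps)
  have dF: "(F has_real_derivative exp (- (a + 1) * \<theta> - y \<theta>) *
      (L (-1) (Suc m) (z \<theta>) * L 1 (Suc (Suc m)) (y \<theta>) * (y \<theta> - z \<theta> - 2 * a - 2))) (at \<theta>)" for \<theta>
    unfolding F_def y_def z_def by (rule cross_wronskian_derivative)
  have "F 0 < F \<tau>"
  proof (rule DERIV_pos_imp_increasing_open[OF \<tau>(1)])
    fix \<theta> assume \<theta>: "0 < \<theta>" "\<theta> < \<tau>"
    have y: "v 0 < y \<theta>" "y \<theta> < v 1"
    proof -
      have "y \<tau> < y \<theta>" "y \<theta> < y 0" using \<theta> v by (simp_all add: y_def)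
      thus "v 0 < y \<theta>" "y \<theta> < v 1" by (simp_all add: y_\<tau> y_0)
    qed
    have "z \<tau> < z \<theta>" using \<theta> w by (simp add: z_def)
    hence z: "w 0 < z \<theta>" using z_\<tau> by linarith
    \<comment> \<open>The difference \<open>y - z\<close> stays below its initial value \<open>v 1 - w 1 < 2 a\<close> because \<open>- w 1 < y\<close>.\<close>
    have "0 \<le> (exp \<theta> - 1) * (y \<theta> + w 1)"
      using \<theta> y w wv by (intro mult_nonneg_nonneg) auto
    also have "\<dots> = v 1 - w 1 - (y \<theta> - z \<theta>)"
      by (simp add: y_def z_def algebra_simps flip: exp_add)
    finally have "y \<theta> - z \<theta> - 2 * a - 2 < 0" using V_less_U[of 1] by simp
    moreover have "L 1 (Suc (Suc m)) (y \<theta>) < 0" using up_next_neg y by simp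
    moreover have "L (-1) (Suc m) (z \<theta>) > 0" using low.P_pos_strict[of m "z \<theta>" "Suc m"] z w_0 by simp
    ultimately have "exp (- (a + 1) * \<theta> - y \<theta>) *
      (L (-1) (Suc m) (z \<theta>) * L 1 (Suc (Suc m)) (y \<theta>) * (y \<theta> - z \<theta> - 2 * a - 2)) > 0"
      by (simp add: mult_neg_neg mult_pos_neg zero_less_mult_iff mult_less_0_iff)
    thus "\<exists>D. (F has_real_derivative D) (at \<theta>) \<and> 0 < D" using dF by blast
  qed (use dF in \<open>auto intro!: DERIV_continuous_on intro: DERIV_subset\<close>)
  moreover have "F 0 = 0"
    using v_is_zero[of 1] w_is_zero[of 1] by (simp add: F_def y_def z_def up_next low_next)
  moreover have "F \<tau> \<le> 0"
  proof -
    have "L 1 (Suc m) (v 0) = 0" using up.P_top[of m] v_0 by simp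
    moreover have "L (-1) (Suc m) (z \<tau>) \<ge> 0"
      using low.P_pos_strict[of m "z \<tau>" "Suc m"] low.P_top[of m] z_\<tau> w_0
      by (cases "z \<tau> = w 0") auto
    moreover have "L 1 (Suc (Suc m)) (v 0) < 0" using up_next_neg[of "v 0"] v by simp
    ultimately show ?thesis by (simp add: F_def y_\<tau> mult_nonneg_nonpos)
  qed
  ultimately show False by simp
qed

section \<open>The theorem\<close>

lemma poly_laguerre_hat:
  "poly (laguerre_hat \<alpha> (Suc m) t) x = (x - a) * L 1 (Suc m) x - t\<^sup>2 * b * L 1 m x"
  by (simp add: laguerre_hat_def signed_laguerre_def a_def b_def algebra_simps)

lemma poly_laguerre_hat':
  "poly (laguerre_hat \<alpha> (Suc m) t) x =
    (-1) ^ m * ((- x + a) * L (-1) (Suc m) (- x) - t\<^sup>2 * b * L (-1) m (- x))"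
  unfolding poly_laguerre_hat
  by (cases "even m") (simp_all add: signed_laguerre_def algebra_simps)

lemma extreme_zeros_prod_eq_zero_prod: "extreme_zeros_prod (Suc m) \<alpha> t = zero_prod (t\<^sup>2)"
proof -
  let ?Z = "{x. poly (laguerre_hat \<alpha> (Suc m) t) x = 0}"
  have t: "0 \<le> t\<^sup>2" by simp
  have "poly (laguerre_hat \<alpha> (Suc m) t) (v (t\<^sup>2) + 1) \<noteq> 0"
    using zero_le_v[OF t, of "v (t\<^sup>2) + 1"] by (auto simp: poly_laguerre_hat)
  hence "finite ?Z" by (intro poly_roots_finite) auto
  moreover have "v (t\<^sup>2) \<in> ?Z" using v_is_zero[OF t] by (simp add: poly_laguerre_hat)
  moreover have "- w (t\<^sup>2) \<in> ?Z" using w_is_zero[OF t] by (simp add: poly_laguerre_hat' add.commute)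
  moreover have "x \<le> v (t\<^sup>2)" if "x \<in> ?Z" for x
    using zero_le_v[OF t] that by (simp add: poly_laguerre_hat)
  moreover have "- w (t\<^sup>2) \<le> x" if "x \<in> ?Z" for x
    using zero_le_w[OF t, of "- x"] that by (simp add: poly_laguerre_hat')
  ultimately have "Max ?Z = v (t\<^sup>2)" "Min ?Z = - w (t\<^sup>2)"
    by (auto intro!: Max_eqI Min_eqI)
  thus ?thesis by (simp add: extreme_zeros_prod_def zero_prod_def)
qed

end

theorem theorem1p2:
  fixes \<alpha> :: real and n :: nat
  assumes "\<alpha> > -1" and "n \<ge> 5"
  shows "(\<exists>!t\<^sub>0. t\<^sub>0 \<in> {0<..<1} \<and>
            strict_mono_on {0..t\<^sub>0} (extreme_zeros_prod n \<alpha>) \<and>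
            strict_antimono_on {t\<^sub>0..1} (extreme_zeros_prod n \<alpha>)) \<and>
         (\<forall>t. 0 < t \<and> t \<le> 1 \<longrightarrow> extreme_zeros_prod n \<alpha> t > extreme_zeros_prod n \<alpha> 0)"
proof -
  define m where "m = n - 1"
  have n: "n = Suc m" using assms by (simp add: m_def)
  interpret laguerre_extremes \<alpha> m by unfold_locales (use assms n in auto)
  let ?g = "extreme_zeros_prod n \<alpha>"
  have g: "?g t = zero_prod (t\<^sup>2)" for t using extreme_zeros_prod_eq_zero_prod n by simp
  obtain s0 where s0: "0 < s0" "s0 < 1"
    and inc: "\<And>x y. 0 \<le> x \<Longrightarrow> x < y \<Longrightarrow> y \<le> s0 \<Longrightarrow> zero_prod x < zero_prod y"
    and dec: "\<And>x y. s0 \<le> x \<Longrightarrow> x < y \<Longrightarrow> y \<le> 1 \<Longrightarrow> zero_prod y < zero_prod x"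
    using zero_prod_unimodal by metis
  define t0 where "t0 = sqrt s0"
  have t0: "0 < t0" "t0 < 1" "t0\<^sup>2 = s0" using s0 by (auto simp: t0_def)
  have sq: "x\<^sup>2 < y\<^sup>2" if "0 \<le> x" "x < y" for x y :: real
    using that by (simp add: power_strict_mono)
  have sq': "x\<^sup>2 \<le> y\<^sup>2" if "0 \<le> x" "x \<le> y" for x y :: real
    using that by (simp add: power_mono)
  have ginc: "strict_mono_on {0..t0} ?g"
    unfolding strict_mono_on_def g
    using inc sq sq'[of _ t0] t0 by auto
  have gdec: "strict_antimono_on {t0..1} ?g"
    unfolding monotone_on_def g
    using dec sq sq'[of t0] sq'[of _ 1] t0 by auto
  have "\<exists>!t. t \<in> {0<..<1} \<and> strict_mono_on {0..t} ?g \<and> strict_antimono_on {t..1} ?g"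
  proof (rule ex1I[of _ t0])
    show "t0 \<in> {0<..<1} \<and> strict_mono_on {0..t0} ?g \<and> strict_antimono_on {t0..1} ?g"
      using t0 ginc gdec by simp
    fix t assume t: "t \<in> {0<..<1} \<and> strict_mono_on {0..t} ?g \<and> strict_antimono_on {t..1} ?g"
    have "\<not> p < q" if "0 < p" "q < 1" "strict_antimono_on {p..1} ?g" "strict_mono_on {0..q} ?g" for p q
    proof
      assume "p < q"
      hence "?g q < ?g p" "?g p < ?g q"
        using that by (auto simp: monotone_on_def strict_mono_on_def)
      thus False by simp
    qed
    from this[of t t0] this[of t0 t] t t0 ginc gdec show "t = t0" by auto
  qed
  moreover have "?g t > ?g 0" if "0 < t" "t \<le> 1" for t
  proof (cases "t \<le> t0")
    case True
    thus ?thesis using inc[of 0 "t\<^sup>2"] sq'[of t t0] that t0 by (simp add: g)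
  next
    case False
    hence "zero_prod 1 \<le> zero_prod (t\<^sup>2)"
      using dec[of "t\<^sup>2" 1] sq'[of t0 t] t0 that sq[of t 1] by (cases "t = 1") auto
    thus ?thesis using zero_prod_0_less_zero_prod_1 by (simp add: g)
  qed
  ultimately show ?thesis by blast
qed

end
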